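(* Let $x=(x_j)_{j\ge 0}$ be a time series in $\mathbb{F}^d$ (an eventually constant sequence), with iterated-sums signature $(\operatorname{ISS}(x)_{n,m})_{0\le n\le m}$. Then: 1. (Quasi-shuffle identity) For all $n\le m$ in $\mathbb{N}$, the linear map $\operatorname{ISS}(x)_{n,m}: T(\mathfrak{A})\to\mathbb{F}$ is a character of the quasi-shuffle Hopf algebra, that is, $\langle e,\operatorname{ISS}(x)_{n,m}\rangle=1$ and for all $u,v\in T(\mathfrak{A})$ $$\langle u\star v,\operatorname{ISS}(x)_{n,m}\rangle=\langle u,\operatorname{ISS}(x)_{n,m}\rangle\,\langle v,\operatorname{ISS}(x)_{n,m}\rangle .$$ 2. (Chen's property) For any $n<n'<n''$ in $\mathbb{N}$, $$\operatorname{ISS}(x)_{n,n'}\cdot\operatorname{ISS}(x)_{n',n''}=\operatorname{ISS}(x)_{n,n''},$$ where $\cdot$ denotes the convolution product of linear functionals on $T(\mathfrak{A})$ with respect to the deconcatenation coproduct.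
   Context: $\mathbb{F}$ is a field of characteristic zero, $d\ge 1$, $\mathbb{N}=\{0,1,2,\dots\}$. Alphabet and words. $A=\{1,\dots,d\}$ is a set of $d$ letters, and $\mathfrak{A}$ is the free commutative semigroup (without unit) generated by $A$; its product is written $[ab]=[ba]$, elements are written $[a_1\cdots a_p]$ with $p\ge1$, $a_i\in A$ (nonempty commutative monomials), and $[a]:=a$ for $a\in\mathfrak{A}$. $T(\mathfrak{A})$ is the tensor algebra over the vector space with basis $\mathfrak{A}$; it has as basis the words $w=w_1\cdots w_k$ in letters $w_i\in\mathfrak{A}$ (also written $[w_1]\cdots[w_k]$), including the empty word $e$. Quasi-shuffle product. $\star$ is the bilinear product on $T(\mathfrak{A})$ with $e\star u=u=u\star e$ and, for words $u,v$ and $a,b\in\mathfrak{A}$, $ua\star vb=(u\star vb)a+(ua\star v)b+(u\star v)[ab]$. Convolution. The deconcatenation coproduct is $\delta(w_1\cdots w_k)=\sum_{i=0}^k w_1\cdots w_i\otimes w_{i+1}\cdots w_k$. For linear functionals $c,c'$ on $T(\mathfrak{A})$, writing $\langle w,c\rangle$ for the value $c(w)$, the convolution product is $\langle w,c\cdot c'\rangle=\sum_{uv=w}\langle u,c\rangle\langle v,c'\rangle$ for words $w$ (sum over all splittings of $w$ into a concatenation of two possibly empty words). The counit $\varepsilon$ is the functional with $\varepsilon(e)=1$ and $\varepsilon(w)=0$ for nonempty words. The quasi-shuffle Hopf algebra is $(T(\mathfrak{A}),\star,\delta,\varepsilon)$. Iterated-sums signature. Write $x_j=(x_j^{[1]},\dots,x_j^{[d]})$,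 $\Delta x_j^{[a]}=x_j^{[a]}-x_{j-1}^{[a]}$ for $a\in A$, $j\ge1$, and for $[a_1\cdots a_p]\in\mathfrak{A}$ set $\Delta x_j^{[a_1\cdots a_p]}:=\Delta x_j^{[a_1]}\cdots\Delta x_j^{[a_p]}$ (product of increments). For $0\le n\le m$, $\operatorname{ISS}(x)_{n,m}$ is the linear map $T(\mathfrak{A})\to\mathbb{F}$ with $\langle e,\operatorname{ISS}(x)_{n,m}\rangle=1$ and, for $u_1,\dots,u_k\in\mathfrak{A}$, $k\ge1$, $$\langle [u_1]\cdots[u_k],\operatorname{ISS}(x)_{n,m}\rangle=\sum_{n<i_1<\cdots<i_k\le m}\Delta x_{i_1}^{[u_1]}\cdots\Delta x_{i_k}^{[u_k]};$$ in particular $\operatorname{ISS}(x)_{n,n}=\varepsilon$. *)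

theory Defs
  imports
    "HOL-Analysis.Finite_Cartesian_Product"
    "HOL-Library.Multiset"
    "HOL-Library.Poly_Mapping"
begin

text \<open>
  Nonempty multisets under multiset sum. The monomial \<open>[a\<^sub>1 \<cdots> a\<^sub>p]\<close> is the multiset
  \<open>{#a\<^sub>1, \<dots>, a\<^sub>p#}\<close>, and the product \<open>[ab]\<close> of two monomials is written \<open>a * b\<close>.
\<close>

typedef 'd monomial = "{M :: 'd multiset. M \<noteq> {#}}"
  by (rule exI[of _ "{#undefined#}"]) simp

setup_lifting type_definition_monomial

instantiation monomial :: (type) ab_semigroup_mult
begin

lift_definition times_monomial :: "'a monomial \<Rightarrow> 'a monomial \<Rightarrow> 'a monomial" is "(+)"
  by simp

instance
  by standard (transfer; simp add: ac_simps)+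

end

text \<open>
  \<open>('l, 'f) tensor\<close> is the vector space over \<open>'f\<close> with basis the words (lists) in letters
  from \<open>'l\<close>; the list \<open>[w\<^sub>1, \<dots>, w\<^sub>k]\<close> stands for \<open>w\<^sub>1 \<cdots> w\<^sub>k\<close> and \<open>[]\<close> for the empty
  word \<open>e\<close>.
\<close>

type_synonym ('l, 'f) tensor = "'l list \<Rightarrow>\<^sub>0 'f"

definition smul :: "'f \<Rightarrow> ('b \<Rightarrow>\<^sub>0 'f) \<Rightarrow> ('b \<Rightarrow>\<^sub>0 'f::field)"
  where "smul c = Poly_Mapping.map ((*) c)"

lemma lookup_smul [simp]: "Poly_Mapping.lookup (smul c p) b = c * Poly_Mapping.lookup p b"
  by (simp add: smul_def Poly_Mapping.map.rep_eq when_def)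

lemma vector_space_smul: "vector_space (smul :: 'f \<Rightarrow> ('b \<Rightarrow>\<^sub>0 'f) \<Rightarrow> ('b \<Rightarrow>\<^sub>0 'f::field))"
  by unfold_locales (auto intro!: poly_mapping_eqI simp: lookup_add algebra_simps)

lemma vector_space_mult: "vector_space ((*) :: 'f::field \<Rightarrow> 'f \<Rightarrow> 'f)"
  by unfold_locales (auto simp: algebra_simps)

abbreviation basis :: "'b \<Rightarrow> ('b \<Rightarrow>\<^sub>0 'f::field)"
  where "basis b \<equiv> Poly_Mapping.single b 1"

text \<open>
  Linear extension of a function on the basis to the free vector space, with values in a
  vector space whose scalar multiplication is \<open>s\<close>.
\<close>

definition lin_ext :: "('f \<Rightarrow> 'v \<Rightarrow> 'v) \<Rightarrow> ('b \<Rightarrow> 'v) \<Rightarrow> ('b \<Rightarrow>\<^sub>0 'f::field) \<Rightarrow> 'v::ab_group_add"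
  where "lin_ext s f p = (\<Sum>b\<in>Poly_Mapping.keys p. s (Poly_Mapping.lookup p b) (f b))"

lemma lin_ext_basis:
  assumes "vector_space s"
  shows "lin_ext s f (basis b) = f b"
proof -
  interpret vector_space s by fact
  show ?thesis by (simp add: lin_ext_def)
qed

lemma linear_lin_ext:
  fixes s :: "'f::field \<Rightarrow> 'v::ab_group_add \<Rightarrow> 'v"
    and f :: "'b \<Rightarrow> 'v"
  assumes "vector_space s"
  shows "Vector_Spaces.linear smul s (lin_ext s f)"
proof -
  interpret S: vector_space s by fact
  have superset: "lin_ext s f p = (\<Sum>b\<in>K. s (Poly_Mapping.lookup p b) (f b))"
    if "finite K" "Poly_Mapping.keys p \<subseteq> K" for p K
    unfolding lin_ext_def using that
    by (intro sum.mono_neutral_left) (auto simp: in_keys_iff)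
  show ?thesis
  proof (subst Vector_Spaces.linear_iff, intro conjI allI vector_space_smul assms)
    fix p q :: "'b \<Rightarrow>\<^sub>0 'f"
    have "Poly_Mapping.keys (p + q) \<subseteq> Poly_Mapping.keys p \<union> Poly_Mapping.keys q"
      by (rule Poly_Mapping.keys_add)
    then show "lin_ext s f (p + q) = lin_ext s f p + lin_ext s f q"
      by (simp add: superset[where K = "Poly_Mapping.keys p \<union> Poly_Mapping.keys q"]
          lookup_add S.scale_left_distrib sum.distrib)
  next
    fix c :: 'f and p :: "'b \<Rightarrow>\<^sub>0 'f"
    have "Poly_Mapping.keys (smul c p) \<subseteq> Poly_Mapping.keys p"
      by (auto simp: in_keys_iff)
    then show "lin_ext s f (smul c p) = s c (lin_ext s f p)"
      by (simp add: superset[where K = "Poly_Mapping.keys p"] S.scale_sum_right)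
  qed
qed

definition append_letter :: "('l, 'f) tensor \<Rightarrow> 'l \<Rightarrow> ('l, 'f::field) tensor"
  where "append_letter p a = lin_ext smul (\<lambda>w. basis (w @ [a])) p"

function qsh_word :: "'l::ab_semigroup_mult list \<Rightarrow> 'l list \<Rightarrow> ('l, 'f::field) tensor" where
  "qsh_word [] v = basis v"
| "qsh_word (u @ [a]) [] = basis (u @ [a])"
| "qsh_word (u @ [a]) (v @ [b]) =
     append_letter (qsh_word u (v @ [b])) a
     + append_letter (qsh_word (u @ [a]) v) b
     + append_letter (qsh_word u v) (a * b)"
proof -
  fix P and x :: "'l list \<times> 'l list"
  assume "\<And>v. x = ([], v) \<Longrightarrow> P" and "\<And>u a. x = (u @ [a], []) \<Longrightarrow> P"
    and "\<And>u a v b. x = (u @ [a], v @ [b]) \<Longrightarrow> P"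
  then show P
    by (cases x) (metis rev_exhaust)
qed auto
termination
  by (relation "measure (\<lambda>(u, v). length u + length v)") auto

definition qsh :: "('l::ab_semigroup_mult, 'f) tensor \<Rightarrow> ('l, 'f) tensor \<Rightarrow> ('l, 'f::field) tensor"
    (infixl \<open>\<star>\<close> 70)
  where "p \<star> q = lin_ext smul (\<lambda>u. lin_ext smul (\<lambda>v. qsh_word u v) q) p"

lemma qsh_basis: "basis u \<star> basis v = qsh_word u v"
  by (simp add: qsh_def lin_ext_basis vector_space_smul)

definition qsh_character :: "(('l::ab_semigroup_mult, 'f::field) tensor \<Rightarrow> 'f) \<Rightarrow> bool"
  where "qsh_character c \<longleftrightarrow>
    Vector_Spaces.linear smul (*) c \<and> c (basis []) = 1 \<and> (\<forall>u v. c (u \<star> v) = c u * c v)"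

text \<open>
  The tensor square is the vector space with basis the pairs of words, the pair \<open>(u, v)\<close>
  standing for \<open>u \<otimes> v\<close>.
\<close>

definition deconc :: "('l, 'f) tensor \<Rightarrow> ('l list \<times> 'l list \<Rightarrow>\<^sub>0 'f::field)"
  where "deconc = lin_ext smul (\<lambda>w. \<Sum>i\<le>length w. basis (take i w, drop i w))"

definition convolution ::
    "(('l, 'f) tensor \<Rightarrow> 'f) \<Rightarrow> (('l, 'f) tensor \<Rightarrow> 'f) \<Rightarrow> ('l, 'f::field) tensor \<Rightarrow> 'f"
  where "convolution c c' p =
    lin_ext (*) (\<lambda>(u, v). c (basis u) * c' (basis v)) (deconc p)"

lemma convolution_basis:
  "convolution c c' (basis w) = (\<Sum>(u, v) | u @ v = w. c (basis u) * c' (basis v))"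
proof -
  let ?f = "\<lambda>(u, v). c (basis u) * c' (basis v)"
  interpret Vector_Spaces.linear smul "(*)" "lin_ext (*) ?f"
    by (rule linear_lin_ext) (rule vector_space_mult)
  have "convolution c c' (basis w) =
      (\<Sum>i\<le>length w. c (basis (take i w)) * c' (basis (drop i w)))"
    by (simp add: convolution_def deconc_def lin_ext_basis vector_space_smul
        vector_space_mult sum)
  also have "\<dots> = (\<Sum>(u, v) | u @ v = w. c (basis u) * c' (basis v))"
    by (rule sum.reindex_bij_witness
        [of _ "\<lambda>(u, v). length u" "\<lambda>i. (take i w, drop i w)"]) auto
  finally show ?thesis .
qed

definition time_series :: "(nat \<Rightarrow> 'f ^ 'd) \<Rightarrow> bool"
  where "time_series x \<longleftrightarrow> (\<exists>N. \<forall>j\<ge>N. x j = x N)"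

text \<open>Only used for \<open>j \<ge> 1\<close>, so the subtraction in \<open>j - 1\<close> does not truncate.\<close>

definition increment :: "(nat \<Rightarrow> 'f ^ 'd) \<Rightarrow> nat \<Rightarrow> 'd monomial \<Rightarrow> 'f::field"
  where "increment x j u = (\<Prod>a\<in>#Rep_monomial u. x j $ a - x (j - 1) $ a)"

text \<open>
  The index tuples \<open>n < i\<^sub>1 < \<cdots> < i\<^sub>k \<le> m\<close> are strictly increasing lists of length \<open>k\<close>.
  For the empty word the only index tuple is \<open>[]\<close> and the value is \<open>1\<close>.
\<close>

definition ISS_word :: "(nat \<Rightarrow> 'f ^ 'd) \<Rightarrow> nat \<Rightarrow> nat \<Rightarrow> 'd monomial list \<Rightarrow> 'f::field"
  where "ISS_word x n m w =
    (\<Sum>is | length is = length w \<and> sorted_wrt (<) is \<and> set is \<subseteq> {n<..m}.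
       \<Prod>j<length w. increment x (is ! j) (w ! j))"

lemma finite_ISS_indices:
  "finite {is. length is = length w \<and> sorted_wrt (<) is \<and> set is \<subseteq> {n<..m::nat}}"
  by (rule finite_subset[OF _ finite_lists_length_eq[of "{n<..m}" "length w"]]) auto

lemma ISS_word_Nil: "ISS_word x n m [] = 1"
proof -
  have "{is. length is = length ([] :: 'c monomial list) \<and> sorted_wrt (<) is \<and>
      set is \<subseteq> {n<..m}} = {[]}"
    by auto
  then show ?thesis by (simp add: ISS_word_def)
qed

definition ISS :: "(nat \<Rightarrow> 'f ^ 'd) \<Rightarrow> nat \<Rightarrow> nat \<Rightarrow> ('d monomial, 'f::field) tensor \<Rightarrow> 'f"
  where "ISS x n m = lin_ext (*) (ISS_word x n m)"

end

(*
  Everything follows from the recursion in the right endpoint: an index tuple in (n, m + 1] either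
  stays within (n, m] or ends in m + 1, so that ISS_{n,m+1}(wa) = ISS_{n,m}(wa) + ISS_{n,m}(w) dx(a),
  where dx(a) is the increment at m + 1. As dx is multiplicative in the letter, the three terms of the
  quasi-shuffle recursion are exactly the cross terms of the product of two such expressions, so the
  character property passes from m to m + 1; it starts from the counit at m = n. Chen's property
  follows by the same induction.
*)

theory Submission
  imports Defs
begin

lemma linear_lin_ext_comp:
  assumes "Vector_Spaces.linear s t c"
  shows "c (lin_ext s f p) = lin_ext t (\<lambda>b. c (f b)) p"
proof -
  interpret Vector_Spaces.linear s t c by fact
  show ?thesis by (simp add: lin_ext_def sum scale)
qed

lemma lin_ext_smul_basis: "lin_ext smul basis p = p"
proof (rule poly_mapping_eqI)
  fix k
  have "Poly_Mapping.lookup (lin_ext smul basis p) k =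
      (\<Sum>b\<in>Poly_Mapping.keys p. if k = b then Poly_Mapping.lookup p b else 0)"
    unfolding lin_ext_def lookup_sum
    by (intro sum.cong) (auto simp: lookup_single when_def)
  also have "\<dots> = Poly_Mapping.lookup p k"
    by (simp add: sum.delta' in_keys_iff)
  finally show "Poly_Mapping.lookup (lin_ext smul basis p) k = Poly_Mapping.lookup p k" .
qed

text \<open>Push the map through the basis expansion of \<open>p\<close> given by
  \<open>lin_ext_smul_basis\<close>. This reduces identities between linear maps to identities on
  basis elements.\<close>

lemma linear_eq_lin_ext:
  assumes "Vector_Spaces.linear smul s c"
  shows "c p = lin_ext s (\<lambda>b. c (basis b)) p"
  using linear_lin_ext_comp[OF assms, of basis p] by (simp add: lin_ext_smul_basis)

text \<open>Both sides are bilinear in \<open>p\<close> and \<open>q\<close>, so the character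
  identity only has to be checked on pairs of words.\<close>

lemma linear_qsh_mult:
  assumes lin: "Vector_Spaces.linear smul (*) c"
    and words: "\<And>u v. c (qsh_word u v) = c (basis u) * c (basis v)"
  shows "c (p \<star> q) = c p * c q"
proof -
  have "c (p \<star> q) = lin_ext (*) (\<lambda>u. lin_ext (*) (\<lambda>v. c (basis u) * c (basis v)) q) p"
    by (simp add: qsh_def linear_lin_ext_comp[OF lin] words)
  also have "\<dots> = lin_ext (*) (\<lambda>u. c (basis u) * c q) p"
    by (subst (3) linear_eq_lin_ext[OF lin]) (simp add: lin_ext_def sum_distrib_left ac_simps)
  also have "\<dots> = c p * c q"
    by (subst (3) linear_eq_lin_ext[OF lin]) (simp add: lin_ext_def sum_distrib_left sum_distrib_right ac_simps)
  finally show ?thesis .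
qed

lemma linear_deconc: "Vector_Spaces.linear smul smul deconc"
  unfolding deconc_def by (rule linear_lin_ext) (rule vector_space_smul)

lemma linear_convolution: "Vector_Spaces.linear smul (*) (convolution c c')"
proof -
  have "convolution c c' = lin_ext (*) (\<lambda>(u, v). c (basis u) * c' (basis v)) \<circ> deconc"
    by (simp add: fun_eq_iff convolution_def)
  then show ?thesis
    using Vector_Spaces.linear_compose[OF linear_deconc linear_lin_ext[OF vector_space_mult]]
    by metis
qed

text \<open>Indexing the splittings by the cut position makes it easy to single out the cut after
  the last letter, as the induction for Chen's property requires.\<close>

lemma convolution_basis_take_drop:
  "convolution c c' (basis w) =
     (\<Sum>i\<le>length w. c (basis (take i w)) * c' (basis (drop i w)))"
  unfolding convolution_basis
  by (rule sum.reindex_bij_witness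
      [of _ "\<lambda>i. (take i w, drop i w)" "\<lambda>(u, v). length u"]) auto

lemma increment_mult: "increment x j (a * b) = increment x j a * increment x j b"
  by (simp add: increment_def times_monomial.rep_eq)

lemma ISS_word_same: "ISS_word x n n w = (if w = [] then 1 else 0)"
proof (cases "w = []")
  case False
  then have "{is. length is = length w \<and> sorted_wrt (<) is \<and> set is \<subseteq> {n<..n}} = {}"
    by auto
  then show ?thesis using False unfolding ISS_word_def by (simp only: sum.empty if_False)
qed (simp add: ISS_word_Nil)

lemma ISS_word_Suc_snoc:
  assumes "n \<le> m"
  shows "ISS_word x n (Suc m) (w @ [a]) =
    ISS_word x n m (w @ [a]) + ISS_word x n m w * increment x (Suc m) a"
proof -
  define I where "I m k = {is. length is = k \<and> sorted_wrt (<) is \<and> set is \<subseteq> {n<..m}}" for m k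
  have fin: "finite (I m k)" for m k
    unfolding I_def by (rule finite_subset[OF _ finite_lists_length_eq[of "{n<..m}" k]]) auto
  have snoc_cases: "is \<in> I m (Suc k) \<union> (\<lambda>is. is @ [Suc m]) ` I m k" if mem: "is \<in> I (Suc m) (Suc k)" for "is" k
  proof -
    obtain js j where js: "is = js @ [j]"
      using mem by (cases "is" rule: rev_cases) (auto simp: I_def)
    show ?thesis
    \<comment> \<open>The last entry bounds all others strictly: if it is \<open>Suc m\<close>, the
      rest lies in \<open>{n<..m}\<close>; otherwise the whole tuple does.\<close>
    proof (cases "j = Suc m")
      case True
      then have "js \<in> I m k" using mem by (force simp: I_def js sorted_wrt_append)
      then show ?thesis using js True by auto
    next
      case False
      then have "is \<in> I m (Suc k)" using mem by (force simp: I_def js sorted_wrt_append)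
      then show ?thesis by auto
    qed
  qed
  have split: "I (Suc m) (Suc k) = I m (Suc k) \<union> (\<lambda>is. is @ [Suc m]) ` I m k" for k
  proof (rule equalityI)
    show "I m (Suc k) \<union> (\<lambda>is. is @ [Suc m]) ` I m k \<subseteq> I (Suc m) (Suc k)"
      \<comment> \<open>\<open>n \<le> m\<close> puts the appended index \<open>Suc m\<close> into
        \<open>{n<..Suc m}\<close>.\<close>
      using assms by (fastforce simp: I_def sorted_wrt_append)
  qed (use snoc_cases in blast)
  have disj: "I m (Suc k) \<inter> (\<lambda>is. is @ [Suc m]) ` I m k = {}" for k
    by (auto simp: I_def)
  let ?P = "\<lambda>w is. \<Prod>j<length w. increment x (is ! j) (w ! j)"
  have snoc: "?P (w @ [a]) (is @ [Suc m]) = ?P w is * increment x (Suc m) a"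
    if "is \<in> I m (length w)" for "is"
    using that by (auto simp: I_def nth_append intro!: prod.cong)
  have "ISS_word x n (Suc m) (w @ [a]) = sum (?P (w @ [a])) (I (Suc m) (Suc (length w)))"
    by (simp add: ISS_word_def I_def)
  also have "\<dots> = sum (?P (w @ [a])) (I m (Suc (length w))) +
      sum (?P (w @ [a])) ((\<lambda>is. is @ [Suc m]) ` I m (length w))"
    unfolding split by (rule sum.union_disjoint) (use fin disj in auto)
  also have "sum (?P (w @ [a])) ((\<lambda>is. is @ [Suc m]) ` I m (length w)) =
      (\<Sum>is\<in>I m (length w). ?P w is * increment x (Suc m) a)"
    by (subst sum.reindex) (auto intro!: sum.cong inj_onI simp: snoc simp del: length_append)
  also have "sum (?P (w @ [a])) (I m (Suc (length w))) = ISS_word x n m (w @ [a])"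
    by (simp add: ISS_word_def I_def)
  also have "(\<Sum>is\<in>I m (length w). ?P w is * increment x (Suc m) a) =
      ISS_word x n m w * increment x (Suc m) a"
    by (simp add: ISS_word_def I_def sum_distrib_right)
  finally show ?thesis .
qed

lemma linear_ISS: "Vector_Spaces.linear smul (*) (ISS x n m)"
  unfolding ISS_def by (rule linear_lin_ext) (rule vector_space_mult)

lemma ISS_basis: "ISS x n m (basis w) = ISS_word x n m w"
  by (simp add: ISS_def lin_ext_basis vector_space_mult)

lemma ISS_append_letter:
  "ISS x n m (append_letter p a) = lin_ext (*) (\<lambda>w. ISS_word x n m (w @ [a])) p"
  by (simp add: append_letter_def linear_lin_ext_comp[OF linear_ISS] ISS_basis)

text \<open>Over an empty interval the signature is the counit, and \<open>append_letter\<close>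
  produces nonempty words only.\<close>

lemma ISS_same_append_letter: "ISS x n n (append_letter p a) = 0"
  by (simp add: ISS_append_letter ISS_word_same lin_ext_def)

text \<open>The recursion in the right endpoint, extended linearly from words to tensors, because
  the quasi-shuffle recursion appends letters to sums of words.\<close>

lemma ISS_Suc_append_letter:
  assumes "n \<le> m"
  shows "ISS x n (Suc m) (append_letter p a) =
    ISS x n m (append_letter p a) + ISS x n m p * increment x (Suc m) a"
  unfolding ISS_append_letter ISS_word_Suc_snoc[OF assms]
  by (simp add: ISS_def lin_ext_def algebra_simps sum.distrib sum_distrib_left)

lemma ISS_add: "ISS x n m (p + q) = ISS x n m p + ISS x n m q"
proof -
  interpret Vector_Spaces.linear smul "(*)" "ISS x n m" by (rule linear_ISS)
  show ?thesis by (rule add)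
qed

lemma qsh_word_Nil_right: "qsh_word u [] = basis u"
  by (cases u rule: rev_cases) auto

lemma ISS_qsh_word:
  assumes "n \<le> m"
  shows "ISS x n m (qsh_word u v) = ISS_word x n m u * ISS_word x n m v"
  using assms
proof (induction m arbitrary: u v rule: dec_induct)
  case base
  show ?case
    by (cases u rule: rev_cases; cases v rule: rev_cases)
      (auto simp: ISS_basis ISS_word_same ISS_add ISS_same_append_letter)
next
  case (step m)
  consider "u = []" | "v = []" | u' a v' b where "u = u' @ [a]" "v = v' @ [b]"
    by (metis rev_exhaust)
  then show ?case
  proof cases
    case (3 u' a v' b)
    let ?S = "ISS_word x n m" and ?dx = "increment x (Suc m)"
    \<comment> \<open>Each of the three quasi-shuffle terms splits in two; the parts without an
      increment reassemble to \<open>qsh_word u v\<close> at level \<open>m\<close>.\<close>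
    have "ISS x n (Suc m) (qsh_word u v) = ISS x n m (qsh_word u v) +
        ISS x n m (qsh_word u' v) * ?dx a + ISS x n m (qsh_word u v') * ?dx b +
        ISS x n m (qsh_word u' v') * ?dx (a * b)"
      by (simp add: 3 ISS_add ISS_Suc_append_letter[OF step.hyps(1)])
    also have "\<dots> = (?S u + ?S u' * ?dx a) * (?S v + ?S v' * ?dx b)"
      \<comment> \<open>The induction hypothesis is applied to four pairs of words, hence the
        generalization over \<open>u\<close> and \<open>v\<close>.\<close>
      by (simp add: step.IH increment_mult algebra_simps)
    finally show ?thesis
      by (simp add: 3 ISS_word_Suc_snoc[OF step.hyps(1)])
  qed (simp_all add: ISS_basis ISS_word_Nil qsh_word_Nil_right)
qed

lemma qsh_character_ISS:
  assumes "n \<le> m"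
  shows "qsh_character (ISS x n m)"
  unfolding qsh_character_def
  using linear_ISS linear_qsh_mult[OF linear_ISS] ISS_qsh_word[OF assms]
  by (metis ISS_basis ISS_word_Nil)

lemma ISS_word_Chen:
  assumes "n \<le> n'" "n' \<le> m"
  shows "(\<Sum>i\<le>length w. ISS_word x n n' (take i w) * ISS_word x n' m (drop i w)) =
    ISS_word x n m w"
  using assms(2)
proof (induction m arbitrary: w rule: dec_induct)
  case base
  \<comment> \<open>The right factor is the counit, so only the cut at the end of \<open>w\<close>
    survives.\<close>
  have "(\<Sum>i\<le>length w. ISS_word x n n' (take i w) * ISS_word x n' n' (drop i w)) =
      (\<Sum>i\<le>length w. if i = length w then ISS_word x n n' w else 0)"
    by (intro sum.cong) (auto simp: ISS_word_same)
  then show ?case by simp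
next
  case (step m)
  show ?case
  proof (cases w rule: rev_cases)
    case Nil
    then show ?thesis by (simp add: ISS_word_Nil)
  next
    case (snoc v a)
    let ?S = "ISS_word x n n'" and ?T = "ISS_word x n' m" and ?dx = "increment x (Suc m) a"
    \<comment> \<open>The cut at the end of \<open>w\<close> gives \<open>?S w\<close>; every other
      cut leaves \<open>a\<close> at the end of the right factor, where the recursion
      applies.\<close>
    have "(\<Sum>i\<le>length w. ?S (take i w) * ISS_word x n' (Suc m) (drop i w)) =
        (\<Sum>i\<le>length v. ?S (take i v) * (?T (drop i v @ [a]) + ?T (drop i v) * ?dx)) + ?S w"
      by (simp add: snoc ISS_word_Nil ISS_word_Suc_snoc[OF step.hyps(1)])
    \<comment> \<open>As \<open>?T []\<close> is 1, the term \<open>?S w\<close> returns as the last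
      summand of the first sum. The induction hypothesis then evaluates both sums, for
      \<open>w\<close> and for \<open>v\<close>.\<close>
    also have "\<dots> = (\<Sum>i\<le>length w. ?S (take i w) * ?T (drop i w)) +
        (\<Sum>i\<le>length v. ?S (take i v) * ?T (drop i v)) * ?dx"
      by (simp add: snoc ISS_word_Nil algebra_simps sum.distrib sum_distrib_left)
    also have "\<dots> = ISS_word x n (Suc m) w"
      using assms(1) step.hyps(1)
      by (simp only: step.IH snoc ISS_word_Suc_snoc order_trans)
    finally show ?thesis .
  qed
qed

text \<open>Both functionals are linear, so agreement on words suffices.\<close>

lemma convolution_ISS:
  assumes "n \<le> n'" "n' \<le> m"
  shows "convolution (ISS x n n') (ISS x n' m) = ISS x n m"
proof
  fix p
  show "convolution (ISS x n n') (ISS x n' m) p = ISS x n m p"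
    by (subst linear_eq_lin_ext[OF linear_convolution])
      (simp add: convolution_basis_take_drop ISS_basis ISS_word_Chen[OF assms] ISS_def[of x n m])
qed

theorem theorem3p4:
  fixes x :: "nat \<Rightarrow> 'f::field_char_0 ^ 'd::finite"
  assumes "time_series x"
  shows "(\<forall>n m. n \<le> m \<longrightarrow> qsh_character (ISS x n m)) \<and>
    (\<forall>n n' n''. n < n' \<longrightarrow> n' < n'' \<longrightarrow>
       convolution (ISS x n n') (ISS x n' n'') = ISS x n n'')"
  by (simp add: qsh_character_ISS convolution_ISS)

end
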